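(* Let $\mathbb{Z}$ be a finite dimensional real inner product space with induced norm $\|\cdot\|$. Let $\mathcal{F}:=\mathcal{A}+\mathcal{B}$, where $\mathcal{A}:\mathbb{Z}\rightrightarrows\mathbb{Z}$ is maximal monotone and $\mathcal{B}:\mathbb{Z}\to\mathbb{Z}$ is single-valued and Lipschitz continuous with modulus $\frac1\beta$ ($\beta>0$). Let $\gamma>0$ and define the single-valued mapping $$\mathcal{R}(z)=z-\mathcal{J}_{\gamma\mathcal{A}}(\mathcal{I}-\gamma\mathcal{B})z,\qquad z\in\mathbb{Z}.$$ Then $\mathcal{R}$ is metrically subregular at $z^*$ for $0\in\mathcal{R}(z^* )$ if and only if $\mathcal{F}$ is metrically subregular at $z^*$ for $0\in\mathcal{F}(z^* )$.
   Context: For an operator $\mathcal{T}:\mathbb{Z}\rightrightarrows\mathbb{Z}$ (set-valued map) and $\gamma>0$, $\mathcal{J}_{\gamma\mathcal{T}}=(\mathcal{I}+\gamma\mathcal{T})^{-1}$ denotes its resolvent, where $\mathcal{I}$ is the identity. ${\rm gph}\,\mathcal{T}=\{(x,y): y\in\mathcal{T}(x)\}$, $\mathcal{T}^{-1}(y)=\{x: y\in\mathcal{T}(x)\}$, and ${\rm dist}(x,S)=\inf_{s\in S}\|x-s\|$ (equal to $+\infty$ if $S=\emptyset$). Lipschitz continuous with modulus $\frac1\beta$ means $\|\mathcal{B}u-\mathcal{B}v\|\le\beta^{-1}\|u-v\|$ for all $u,v$. An operator $\mathcal{T}$ (single-valued mappings being regarded as operators) is metrically subregular at $\overline{x}$ for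 $\overline{y}\in\mathcal{T}(\overline{x})$, i.e. at $(\overline{x},\overline{y})\in{\rm gph}\,\mathcal{T}$, if there exist a constant $\kappa>0$ and a neighborhood $U$ of $\overline{x}$ such that ${\rm dist}(x,\mathcal{T}^{-1}(\overline{y}))\le\kappa\,{\rm dist}(\overline{y},\mathcal{T}x)$ for all $x\in U$. *)

theory Defs
  imports "HOL-Analysis.Analysis"
begin

text \<open>A set-valued operator on \<open>'a\<close> is a function \<open>'a \<Rightarrow> 'a set\<close>; empty values are allowed.\<close>

definition graph_op :: "('a \<Rightarrow> 'b set) \<Rightarrow> ('a \<times> 'b) set" where
  "graph_op T = {(x, y). y \<in> T x}"

definition inverse_op :: "('a \<Rightarrow> 'b set) \<Rightarrow> 'b \<Rightarrow> 'a set" where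
  "inverse_op T y = {x. y \<in> T x}"

definition monotone_op :: "('a::real_inner \<Rightarrow> 'a set) \<Rightarrow> bool" where
  "monotone_op T \<longleftrightarrow>
     (\<forall>(x, u) \<in> graph_op T. \<forall>(y, v) \<in> graph_op T. inner (x - y) (u - v) \<ge> 0)"

definition maximal_monotone_op :: "('a::real_inner \<Rightarrow> 'a set) \<Rightarrow> bool" where
  "maximal_monotone_op T \<longleftrightarrow>
     monotone_op T \<and>
     (\<forall>S. monotone_op S \<and> graph_op T \<subseteq> graph_op S \<longrightarrow> graph_op S = graph_op T)"

definition resolvent :: "real \<Rightarrow> ('a::real_vector \<Rightarrow> 'a set) \<Rightarrow> 'a \<Rightarrow> 'a set" where
  "resolvent \<gamma> T = inverse_op (\<lambda>x. {x + \<gamma> *\<^sub>R u | u. u \<in> T x})"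

text \<open>For maximal monotone \<open>A\<close> on a finite-dimensional (or Hilbert) space and \<open>\<gamma> > 0\<close>,
  the values of \<open>resolvent \<gamma> A\<close> are singletons by Minty's theorem, so \<open>the_elem\<close> picks
  the unique value of the resolvent.\<close>

definition fb_residual ::
    "real \<Rightarrow> ('a::real_vector \<Rightarrow> 'a set) \<Rightarrow> ('a \<Rightarrow> 'a) \<Rightarrow> 'a \<Rightarrow> 'a" where
  "fb_residual \<gamma> A B z = z - the_elem (resolvent \<gamma> A (z - \<gamma> *\<^sub>R B z))"

text \<open>Extended-real valued, so that the distance to the empty set is \<open>\<infinity>\<close>; the library's
  \<^const>\<open>infdist\<close> returns \<open>0\<close> there.\<close>

definition set_dist :: "'a::real_normed_vector \<Rightarrow> 'a set \<Rightarrow> ereal" where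
  "set_dist x S = (INF s\<in>S. ereal (norm (x - s)))"

definition metrically_subregular ::
    "('a::real_normed_vector \<Rightarrow> 'b::real_normed_vector set) \<Rightarrow> 'a \<Rightarrow> 'b \<Rightarrow> bool" where
  "metrically_subregular T xbar ybar \<longleftrightarrow>
     (xbar, ybar) \<in> graph_op T \<and>
     (\<exists>\<kappa>::real. \<kappa> > 0 \<and> (\<exists>U. open U \<and> xbar \<in> U \<and>
        (\<forall>x\<in>U. set_dist x (inverse_op T ybar) \<le> ereal \<kappa> * set_dist ybar (T x))))"

end

theory Submission
  imports Defs
begin

text \<open>Write \<open>J\<close> for the resolvent of \<open>\<gamma>A\<close>, \<open>R\<close> for the residual and \<open>F = A + B\<close>. The operators
  \<open>R\<close> and \<open>F\<close> have the same zeros, so subregularity at \<open>zstar\<close> compares two measures of how far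
  a point is from being a zero, and each is controlled by the other.
  If \<open>v = a + B z\<close> with \<open>a \<in> A z\<close>, then \<open>z = J (z + \<gamma>a)\<close>, and since \<open>J\<close> is nonexpansive,
  \<open>\<parallel>R z\<parallel> = \<parallel>J (z + \<gamma>a) - J (z - \<gamma>B z)\<parallel> \<le> \<gamma>\<parallel>v\<parallel>\<close>; hence subregularity of \<open>R\<close> with
  constant \<open>\<kappa>\<close> gives that of \<open>F\<close> with constant \<open>\<kappa>\<gamma>\<close>.
  Conversely, the point \<open>p = z - R z = J (z - \<gamma>B z)\<close> satisfies
  \<open>R z / \<gamma> - B z + B p \<in> F p\<close>, an element of norm at most
  \<open>(1/\<gamma> + 1/\<beta>)\<parallel>R z\<parallel>\<close>, while \<open>p\<close> is at distance \<open>\<parallel>R z\<parallel>\<close> from \<open>z\<close> and is close to \<open>zstar\<close>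
  whenever \<open>z\<close> is. Subregularity of \<open>F\<close> at \<open>p\<close> and the triangle inequality then give that
  of \<open>R\<close> with constant \<open>1 + \<kappa>(1/\<gamma> + 1/\<beta>)\<close>.

  All this presupposes that \<open>J\<close> is defined everywhere, which is Minty's theorem (lemma \<open>Minty\<close>).
  By maximality it reduces to solving the system \<open>\<langle>x - y, x + v\<rangle> \<le> 0\<close>, with \<open>(y, v)\<close> ranging over a
  monotone set (lemma \<open>Debrunner_Flor\<close>). Each solution set is a closed ball; finite subsystems
  are solvable by a duality argument (lemma \<open>Debrunner_Flor_finite\<close>), and the
  finite intersection property does the rest, as balls in a finitely spanned inner product space
  lie in compact sets (lemma \<open>norm_le_subset_compact\<close>).\<close>

section \<open>Balls in a finitely spanned inner product space\<close>

lemma compact_scaled_sum_box: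
  fixes C :: "'a::real_normed_vector set"
  assumes "finite C"
  shows "compact {\<Sum>b\<in>C. u b *\<^sub>R b |u. \<forall>b\<in>C. \<bar>u b\<bar> \<le> M b}"
  using assms
proof (induction C)
  case empty
  then show ?case by simp
next
  case (insert a C)
  let ?K = "\<lambda>D. {\<Sum>b\<in>D. u b *\<^sub>R b |u. \<forall>b\<in>D. \<bar>u b\<bar> \<le> M b}"
  have "?K (insert a C) = (\<lambda>(t, x). t *\<^sub>R a + x) ` ({- M a..M a} \<times> ?K C)"
  proof (intro set_eqI iffI)
    fix x assume "x \<in> ?K (insert a C)"
    then obtain u where "x = (\<Sum>b\<in>insert a C. u b *\<^sub>R b)" "\<forall>b\<in>insert a C. \<bar>u b\<bar> \<le> M b"
      by blast
    then have "x = u a *\<^sub>R a + (\<Sum>b\<in>C. u b *\<^sub>R b)"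
      and "u a \<in> {- M a..M a}" "\<forall>b\<in>C. \<bar>u b\<bar> \<le> M b"
      using insert.hyps by (simp_all add: abs_le_iff)
    then show "x \<in> (\<lambda>(t, x). t *\<^sub>R a + x) ` ({- M a..M a} \<times> ?K C)"
      by (intro image_eqI[where x = "(u a, \<Sum>b\<in>C. u b *\<^sub>R b)"] SigmaI CollectI
          exI[of _ u] conjI) simp_all
  next
    fix x assume "x \<in> (\<lambda>(t, x). t *\<^sub>R a + x) ` ({- M a..M a} \<times> ?K C)"
    then obtain t u where tu: "x = t *\<^sub>R a + (\<Sum>b\<in>C. u b *\<^sub>R b)"
      "- M a \<le> t" "t \<le> M a" "\<forall>b\<in>C. \<bar>u b\<bar> \<le> M b"
      by clarsimp
    have "(\<Sum>b\<in>C. (u(a := t)) b *\<^sub>R b) = (\<Sum>b\<in>C. u b *\<^sub>R b)"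
      using insert.hyps by (intro sum.cong) auto
    then have "x = (\<Sum>b\<in>insert a C. (u(a := t)) b *\<^sub>R b)"
      using tu insert.hyps by simp
    moreover have "\<forall>b\<in>insert a C. \<bar>(u(a := t)) b\<bar> \<le> M b"
      using tu by auto
    ultimately show "x \<in> ?K (insert a C)"
      by (intro CollectI exI[of _ "u(a := t)"] conjI)
  qed
  moreover have "compact ((\<lambda>(t, x). t *\<^sub>R a + x) ` ({- M a..M a} \<times> ?K C))"
    unfolding case_prod_unfold
    by (intro compact_continuous_image compact_Times insert.IH compact_Icc continuous_intros)
  ultimately show ?case by (simp only:)
qed

lemma orthogonal_expansion:
  fixes C :: "'a::real_inner set"
  assumes "finite C" and orth: "pairwise orthogonal C" and x: "x \<in> span C"
  shows "x = (\<Sum>b\<in>C. (inner x b / inner b b) *\<^sub>R b)"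
proof -
  let ?p = "\<Sum>b\<in>C. (inner x b / inner b b) *\<^sub>R b"
  have "orthogonal (x - ?p) c" if "c \<in> C" for c
  proof -
    have "inner ?p c = (\<Sum>b\<in>C. if b = c then inner x c else 0)"
      unfolding inner_sum_left
    proof (rule sum.cong)
      fix b assume "b \<in> C"
      then have "b \<noteq> c \<Longrightarrow> inner b c = 0"
        using orth that by (auto simp: pairwise_def orthogonal_def)
      then show "inner ((inner x b / inner b b) *\<^sub>R b) c = (if b = c then inner x c else 0)"
        by auto
    qed simp
    also have "\<dots> = inner x c"
      using assms(1) that by simp
    finally show ?thesis by (simp add: orthogonal_def inner_diff_left)
  qed
  moreover have "x - ?p \<in> span C"
    by (rule span_diff[OF x]) (intro span_sum span_scale span_base)
  ultimately have "orthogonal (x - ?p) (x - ?p)"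
    by (blast intro: orthogonal_to_span)
  then have "x - ?p = 0"
    by (simp add: orthogonal_def)
  then show ?thesis by (rule eq_iff_diff_eq_0[THEN iffD2])
qed

text \<open>The type is only known to be spanned by a finite set, so the Heine--Borel theorem for
  class \<^class>\<open>euclidean_space\<close> does not apply. Instead the ball is enclosed in a box
  with respect to an orthogonal spanning set. That set may contain \<open>0\<close>; since
  \<open>x / 0 = 0\<close>, this vector only contributes zero coefficients and the bound \<open>0\<close>.\<close>

lemma norm_le_subset_compact:
  fixes r :: real
  assumes "\<exists>S::'a set. finite S \<and> span S = UNIV"
  obtains K :: "'a::real_inner set" where "compact K" "{x. norm x \<le> r} \<subseteq> K"
proof -
  obtain C :: "'a set" where C: "finite C" "pairwise orthogonal C" "span C = UNIV"
    using assms basis_orthogonal by metis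
  let ?K = "{\<Sum>b\<in>C. u b *\<^sub>R b |u. \<forall>b\<in>C. \<bar>u b\<bar> \<le> r / norm b}"
  have "x \<in> ?K" if "norm x \<le> r" for x
  proof -
    have "\<bar>inner x b / inner b b\<bar> \<le> r / norm b" for b
    proof (cases "b = 0")
      case False
      have "\<bar>inner x b\<bar> \<le> r * norm b"
        using Cauchy_Schwarz_ineq2[of x b] mult_right_mono[OF that, of "norm b"] by simp
      then show ?thesis
        using False by (simp add: dot_square_norm abs_divide field_simps power2_eq_square)
    qed simp
    moreover have "x = (\<Sum>b\<in>C. (inner x b / inner b b) *\<^sub>R b)"
      using C by (intro orthogonal_expansion) auto
    ultimately show ?thesis
      by (intro CollectI exI[of _ "\<lambda>b. inner x b / inner b b"]) simp
  qed
  then have "{x. norm x \<le> r} \<subseteq> ?K" by (intro subsetI) simp_all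
  with compact_scaled_sum_box[OF C(1)] show ?thesis by (rule that)
qed

section \<open>The Debrunner--Flor inequality and Minty's theorem\<close>

text \<open>For a convex combination of points of a monotone set, the averaged pairing dominates the
  pairing of the averages.\<close>

lemma convex_hull_monotone_pairing:
  fixes F :: "('a::real_inner \<times> 'a) set"
  assumes mono: "\<And>y v y' v'. (y, v) \<in> F \<Longrightarrow> (y', v') \<in> F \<Longrightarrow> inner (y - y') (v - v') \<ge> 0"
    and p: "(y, v, c) \<in> convex hull ((\<lambda>(y, v). (y, v, inner y v)) ` F)"
  shows "c \<ge> inner y v"
proof -
  let ?H = "convex hull ((\<lambda>(y, v). (y, v, inner y v)) ` F)"
  \<comment> \<open>A halfspace in the pairing coordinates that contains every generator
    contains the hull; this is used once for each of the two arguments.\<close>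
  have half: "?H \<subseteq> {q. inner (- v', - y', 1) q \<ge> - c'}"
    if "\<And>y v. (y, v) \<in> F \<Longrightarrow> inner y v + c' \<ge> inner y v' + inner y' v" for y' v' c'
    using that
    by (intro hull_minimal convex_halfspace_ge)
      (auto simp: inner_commute algebra_simps)
  have step: "inner y' v' + c \<ge> inner y' v + inner y v'" if "(y', v') \<in> F" for y' v'
  proof -
    have "?H \<subseteq> {q. inner (- v', - y', 1) q \<ge> - inner y' v'}"
      using mono[OF _ that] by (intro half) (fastforce simp: inner_diff_left inner_diff_right inner_commute)
    then show ?thesis using p by (auto simp: inner_commute)
  qed
  have "?H \<subseteq> {q. inner (- v, - y, 1) q \<ge> - c}"
    using step by (intro half) auto
  then show ?thesis using p by (auto simp: inner_commute)
qed

text \<open>The point \<open>x\<close> comes from Lagrange duality for minimizing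
  \<open>max\<^sub>i \<langle>x - y\<^sub>i, x + v\<^sub>i\<rangle>\<close>: the dual function is
  \<open>- \<parallel>v - y\<parallel>\<^sup>2 / 4 - c\<close> on the convex hull of the triples
  \<open>(y\<^sub>i, v\<^sub>i, \<langle>y\<^sub>i, v\<^sub>i\<rangle>)\<close>, and monotonicity makes it nonpositive there. At a maximizer \<open>(y, v, c)\<close> of the dual,
  \<open>x = (y - v) / 2\<close> minimizes the Lagrangian, and first-order optimality in the direction of the
  \<open>i\<close>-th generator bounds \<open>\<langle>x - y\<^sub>i, x + v\<^sub>i\<rangle>\<close> by the dual optimum.\<close>

lemma Debrunner_Flor_finite:
  fixes F :: "('a::real_inner \<times> 'a) set"
  assumes "finite F" "F \<noteq> {}"
    and mono: "\<And>y v y' v'. (y, v) \<in> F \<Longrightarrow> (y', v') \<in> F \<Longrightarrow> inner (y - y') (v - v') \<ge> 0"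
  shows "\<exists>x. \<forall>(y, v)\<in>F. inner (x - y) (x + v) \<le> 0"
proof -
  let ?H = "convex hull ((\<lambda>(y, v). (y, v, inner y v)) ` F)"
  define \<phi> :: "'a \<times> 'a \<times> real \<Rightarrow> real"
    where "\<phi> = (\<lambda>p. - (norm (fst (snd p) - fst p))\<^sup>2 / 4 - snd (snd p))"
  have "compact ?H" "?H \<noteq> {}"
    using assms by (auto intro!: finite_imp_compact_convex_hull)
  moreover have "continuous_on ?H \<phi>"
    unfolding \<phi>_def by (intro continuous_intros) auto
  ultimately obtain p where p: "p \<in> ?H" and max: "\<And>q. q \<in> ?H \<Longrightarrow> \<phi> q \<le> \<phi> p"
    using continuous_attains_sup[of ?H \<phi>] by blast
  obtain y v c where [simp]: "p = (y, v, c)" by (cases p)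
  define w where "w = v - y"
  define x where "x = - (1/2) *\<^sub>R w"
  have "inner y v \<le> c"
    using p by (intro convex_hull_monotone_pairing[OF mono]) auto
  moreover have "inner w w + 4 * inner y v = inner (v + y) (v + y)"
    by (simp add: w_def inner_add_left inner_add_right inner_diff_left inner_diff_right inner_commute)
  moreover have "inner (v + y) (v + y) \<ge> 0" by simp
  ultimately have nonpos: "- inner w w / 4 - c \<le> 0" by linarith
  have "inner (x - y') (x + v') \<le> 0" if F: "(y', v') \<in> F" for y' v'
  proof -
    define d where "d = (v' - y') - w"
    define e where "e = inner y' v' - c"
    let ?q = "(y', v', inner y' v')"
    have q: "?q \<in> ?H"
      using F by (intro hull_inc) force
    have key: "- inner w d / 2 - e \<le> t * (inner d d / 4)" if "0 < t" "t \<le> 1" for t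
    proof -
      have "(1 - t) *\<^sub>R p + t *\<^sub>R ?q \<in> ?H"
        using p q that by (intro convexD[OF convex_convex_hull]) auto
      then have "\<phi> ((1 - t) *\<^sub>R p + t *\<^sub>R ?q) \<le> \<phi> p" by (rule max)
      moreover have "(1 - t) *\<^sub>R v + t *\<^sub>R v' - ((1 - t) *\<^sub>R y + t *\<^sub>R y') = w + t *\<^sub>R d"
        by (simp add: w_def d_def algebra_simps)
      moreover have "(1 - t) * c + t * inner y' v' = c + t * e"
        by (simp add: e_def algebra_simps)
      ultimately have "- (norm (w + t *\<^sub>R d))\<^sup>2 / 4 - (c + t * e) \<le> - (norm w)\<^sup>2 / 4 - c"
        by (simp add: \<phi>_def w_def)
      moreover have "(norm (w + t *\<^sub>R d))\<^sup>2 = (norm w)\<^sup>2 + 2 * t * inner w d + t * t * inner d d"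
        by (simp add: power2_norm_eq_inner inner_add_left inner_add_right inner_commute
            algebra_simps)
      ultimately have "t * (- inner w d / 2 - e) \<le> t * (t * (inner d d / 4))"
        by (simp add: field_simps)
      then show ?thesis using that by (simp add: mult_le_cancel_left)
    qed
    \<comment> \<open>Letting \<open>t\<close> tend to zero gives the first-order optimality condition.\<close>
    have "((\<lambda>t. t * (inner d d / 4)) \<longlongrightarrow> 0 * (inner d d / 4)) (at_right 0)"
      by (intro tendsto_intros)
    moreover have "\<forall>\<^sub>F t in at_right 0. - inner w d / 2 - e \<le> t * (inner d d / 4)"
      unfolding eventually_at_right[OF zero_less_one] using key by (intro exI[of _ 1]) auto
    ultimately have "- inner w d / 2 - e \<le> 0"
      by (metis mult_zero_left tendsto_lowerbound trivial_limit_at_right_real)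
    moreover have "inner (x - y') (x + v') = inner x x + inner x (v' - y') - inner y' v'"
      by (simp add: inner_add_left inner_add_right inner_diff_left inner_diff_right inner_commute)
    moreover have "inner x x = inner w w / 4" "inner x (v' - y') = - inner w d / 2 - inner w w / 2"
      by (simp_all add: x_def d_def inner_diff_right inner_add_right field_simps)
    ultimately show ?thesis using nonpos e_def by linarith
  qed
  then show ?thesis by (intro exI[of _ x]) auto
qed

lemma Debrunner_Flor:
  fixes G :: "('a::real_inner \<times> 'a) set"
  assumes fin: "\<exists>S::'a set. finite S \<and> span S = UNIV"
    and mono: "\<And>y v y' v'. (y, v) \<in> G \<Longrightarrow> (y', v') \<in> G \<Longrightarrow> inner (y - y') (v - v') \<ge> 0"
  shows "\<exists>x. \<forall>(y, v)\<in>G. inner (x - y) (x + v) \<le> 0"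
proof (cases "G = {}")
  case False
  then obtain y0 v0 where G0: "(y0, v0) \<in> G" by auto
  let ?C = "\<lambda>(y, v). {x. inner (x - y) (x + v) \<le> 0}"
  \<comment> \<open>One of the solution sets is enough to confine all solutions to a bounded region.\<close>
  define r where "r = norm (y0 - v0) + norm (inner y0 v0) + 1"
  obtain K :: "'a set" where K: "compact K" "{x. norm x \<le> r} \<subseteq> K"
    using norm_le_subset_compact[OF fin] by blast
  have bound: "norm x \<le> r" if "inner (x - y0) (x + v0) \<le> 0" for x
  proof (rule ccontr)
    assume "\<not> norm x \<le> r"
    then have x: "norm x > r" by simp
    have "r \<ge> 1" unfolding r_def by simp
    have "norm x * norm x = inner (x - y0) (x + v0) + inner x (y0 - v0) + inner y0 v0"
      by (simp add: power2_norm_eq_inner[symmetric, unfolded power2_eq_square]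
          inner_add_left inner_add_right inner_diff_left inner_diff_right inner_commute)
    also have "\<dots> \<le> norm x * norm (y0 - v0) + norm (inner y0 v0)"
      using that norm_cauchy_schwarz[of x "y0 - v0"] by (simp add: abs_le_iff)
    also have "\<dots> \<le> norm x * norm (y0 - v0) + norm x * norm (inner y0 v0)"
      using x \<open>r \<ge> 1\<close> mult_right_mono[of 1 "norm x" "norm (inner y0 v0)"] by simp
    also have "\<dots> < norm x * norm (y0 - v0) + norm x * norm (inner y0 v0) + norm x"
      using x \<open>r \<ge> 1\<close> by linarith
    also have "\<dots> = norm x * r"
      by (simp add: r_def algebra_simps)
    finally show False using x \<open>r \<ge> 1\<close> mult_strict_left_mono[OF x, of "norm x"] by linarith
  qed
  have "K \<inter> (\<Inter>g\<in>G. ?C g) \<noteq> {}"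
  proof (rule compact_imp_fip_image[OF K(1)])
    fix g assume "g \<in> G"
    show "closed (?C g)"
      unfolding case_prod_unfold by (intro closed_Collect_le continuous_intros)
  next
    fix F assume F: "finite F" "F \<subseteq> G"
    have "\<exists>x. \<forall>(y, v)\<in>insert (y0, v0) F. inner (x - y) (x + v) \<le> 0"
      using F G0 mono by (intro Debrunner_Flor_finite) blast+
    then obtain x where x: "\<forall>(y, v)\<in>insert (y0, v0) F. inner (x - y) (x + v) \<le> 0" ..
    then have "x \<in> K" using bound K(2) by auto
    then show "K \<inter> (\<Inter>g\<in>F. ?C g) \<noteq> {}" using x by auto
  qed
  then obtain x where "x \<in> (\<Inter>g\<in>G. ?C g)" by blast
  then show ?thesis by (intro exI[of _ x]) auto
qed simp

text \<open>A point that is monotonically related to the whole graph belongs to it, as otherwise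
  adding it would give a proper monotone extension.\<close>

lemma maximal_monotone_opD:
  assumes A: "maximal_monotone_op A"
    and x: "\<And>y v. v \<in> A y \<Longrightarrow> inner (x - y) (u - v) \<ge> 0"
  shows "u \<in> A x"
proof -
  define S where "S = A(x := insert u (A x))"
  have "monotone_op S"
    unfolding monotone_op_def
  proof clarify
    fix y v y' v' assume "(y, v) \<in> graph_op S" "(y', v') \<in> graph_op S"
    then have "(y = x \<and> v = u) \<or> v \<in> A y" "(y' = x \<and> v' = u) \<or> v' \<in> A y'"
      by (auto simp: S_def graph_op_def split: if_splits)
    moreover have "inner (y - y') (v - v') \<ge> 0" if "v \<in> A y" "v' \<in> A y'"
      using A that by (fastforce simp: maximal_monotone_op_def monotone_op_def graph_op_def)
    moreover have "inner (y - x) (v - u) = inner (x - y) (u - v)" for y v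
      by (simp add: inner_diff_left inner_diff_right)
    ultimately show "0 \<le> inner (y - y') (v - v')" using x by auto
  qed
  moreover have "graph_op A \<subseteq> graph_op S"
    by (auto simp: S_def graph_op_def)
  ultimately have "graph_op S = graph_op A"
    using A by (simp add: maximal_monotone_op_def)
  moreover have "(x, u) \<in> graph_op S" by (simp add: S_def graph_op_def)
  ultimately show ?thesis by (simp add: graph_op_def)
qed

theorem Minty:
  fixes A :: "'a::real_inner \<Rightarrow> 'a set"
  assumes fin: "\<exists>S::'a set. finite S \<and> span S = UNIV"
    and A: "maximal_monotone_op A" and \<gamma>: "\<gamma> > 0"
  shows "\<exists>x. \<exists>u\<in>A x. z = x + \<gamma> *\<^sub>R u"
proof -
  let ?G = "{(y, \<gamma> *\<^sub>R v - z) |y v. v \<in> A y}"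
  have "\<exists>x. \<forall>(y, v)\<in>?G. inner (x - y) (x + v) \<le> 0"
  proof (rule Debrunner_Flor[OF fin])
    fix y v y' v' assume "(y, v) \<in> ?G" "(y', v') \<in> ?G"
    then obtain a a' where a: "v = \<gamma> *\<^sub>R a - z" "a \<in> A y" "v' = \<gamma> *\<^sub>R a' - z" "a' \<in> A y'" by auto
    have "inner (y - y') (a - a') \<ge> 0"
      using A a by (fastforce simp: maximal_monotone_op_def monotone_op_def graph_op_def)
    moreover have "v - v' = \<gamma> *\<^sub>R (a - a')" unfolding a by (simp add: algebra_simps)
    ultimately show "inner (y - y') (v - v') \<ge> 0" using \<gamma> by simp
  qed
  then obtain x where x: "\<And>y v. v \<in> A y \<Longrightarrow> inner (x - y) (x + (\<gamma> *\<^sub>R v - z)) \<le> 0" by blast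
  define u where "u = (1 / \<gamma>) *\<^sub>R (z - x)"
  have "u \<in> A x"
  proof (rule maximal_monotone_opD[OF A])
    fix y v assume "v \<in> A y"
    have "x + (\<gamma> *\<^sub>R v - z) = - \<gamma> *\<^sub>R (u - v)"
      using \<gamma> by (simp add: u_def algebra_simps)
    then have "inner (x - y) (x + (\<gamma> *\<^sub>R v - z)) = - \<gamma> * inner (x - y) (u - v)"
      by (simp only: inner_scaleR_right)
    with x[OF \<open>v \<in> A y\<close>] show "inner (x - y) (u - v) \<ge> 0"
      using \<gamma> by (simp add: zero_le_mult_iff)
  qed
  moreover have "z = x + \<gamma> *\<^sub>R u" using \<gamma> by (simp add: u_def)
  ultimately show ?thesis by blast
qed

section \<open>The resolvent\<close>

lemma monotone_resolvent_nonexpansive: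
  fixes A :: "'a::real_inner \<Rightarrow> 'a set"
  assumes "monotone_op A" "\<gamma> > 0" "u \<in> A x" "v \<in> A y"
  shows "norm (x - y) \<le> norm ((x + \<gamma> *\<^sub>R u) - (y + \<gamma> *\<^sub>R v))"
proof -
  have m: "inner (x - y) (u - v) \<ge> 0"
    using assms by (fastforce simp: monotone_op_def graph_op_def)
  have "(norm (x - y))\<^sup>2 \<le> (norm ((x - y) + \<gamma> *\<^sub>R (u - v)))\<^sup>2"
  proof -
    have "(norm ((x - y) + \<gamma> *\<^sub>R (u - v)))\<^sup>2
        = (norm (x - y))\<^sup>2 + 2 * (\<gamma> * inner (x - y) (u - v)) + (norm (\<gamma> *\<^sub>R (u - v)))\<^sup>2"
      by (simp only: power2_norm_eq_inner inner_add_left inner_add_right inner_scaleR_right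
          inner_commute[of "\<gamma> *\<^sub>R (u - v)" "x - y"])
        (simp add: algebra_simps)
    moreover have "\<gamma> * inner (x - y) (u - v) \<ge> 0" using m assms by simp
    ultimately show ?thesis using zero_le_power2[of "norm (\<gamma> *\<^sub>R (u - v))"] by linarith
  qed
  then have "norm (x - y) \<le> norm ((x - y) + \<gamma> *\<^sub>R (u - v))"
    by (rule power2_le_imp_le) simp
  then show ?thesis by (simp add: algebra_simps)
qed

text \<open>Monotonicity makes the resolvent at most single-valued, and under maximality Minty's
  theorem makes it nonempty. So \<open>the_elem\<close> yields its actual value: the unique \<open>x\<close> such that
  \<open>z = x + \<gamma>u\<close> for some \<open>u \<in> A x\<close>.\<close>

lemma resolvent_eqI:
  fixes A :: "'a::real_inner \<Rightarrow> 'a set"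
  assumes "monotone_op A" "\<gamma> > 0" "u \<in> A x"
  shows "the_elem (resolvent \<gamma> A (x + \<gamma> *\<^sub>R u)) = x"
proof -
  have "y = x" if "v \<in> A y" "x + \<gamma> *\<^sub>R u = y + \<gamma> *\<^sub>R v" for y v
    using monotone_resolvent_nonexpansive[OF assms(1,2) that(1) assms(3)] that(2) by simp
  then have "resolvent \<gamma> A (x + \<gamma> *\<^sub>R u) = {x}"
    using assms(3) unfolding resolvent_def inverse_op_def by blast
  then show ?thesis by simp
qed

lemma resolventE:
  fixes A :: "'a::real_inner \<Rightarrow> 'a set"
  assumes "\<exists>S::'a set. finite S \<and> span S = UNIV" "maximal_monotone_op A" "\<gamma> > 0"
  obtains u where "u \<in> A (the_elem (resolvent \<gamma> A z))"
    "z = the_elem (resolvent \<gamma> A z) + \<gamma> *\<^sub>R u"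
proof -
  obtain x u where "u \<in> A x" "z = x + \<gamma> *\<^sub>R u"
    using Minty[OF assms] by blast
  moreover have "monotone_op A"
    using assms(2) by (simp add: maximal_monotone_op_def)
  ultimately show ?thesis
    using that resolvent_eqI[of A \<gamma> u x] assms(3) by simp
qed

lemma resolvent_nonexpansive:
  fixes A :: "'a::real_inner \<Rightarrow> 'a set"
  assumes "\<exists>S::'a set. finite S \<and> span S = UNIV" "maximal_monotone_op A" "\<gamma> > 0"
  shows "norm (the_elem (resolvent \<gamma> A z) - the_elem (resolvent \<gamma> A z')) \<le> norm (z - z')"
proof -
  obtain u where u: "u \<in> A (the_elem (resolvent \<gamma> A z))"
      "z = the_elem (resolvent \<gamma> A z) + \<gamma> *\<^sub>R u"
    using resolventE[OF assms] .
  obtain u' where u': "u' \<in> A (the_elem (resolvent \<gamma> A z'))"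
      "z' = the_elem (resolvent \<gamma> A z') + \<gamma> *\<^sub>R u'"
    using resolventE[OF assms] .
  have "monotone_op A"
    using assms(2) by (simp add: maximal_monotone_op_def)
  from monotone_resolvent_nonexpansive[OF this assms(3) u(1) u'(1)] show ?thesis
    using u(2) u'(2) by simp
qed

section \<open>The two subregularity estimates\<close>

lemma set_dist_le: "s \<in> S \<Longrightarrow> set_dist x S \<le> ereal (norm (x - s))"
  unfolding set_dist_def by (rule INF_lower)

lemma set_dist_singleton [simp]: "set_dist x {s} = ereal (norm (x - s))"
  unfolding set_dist_def by simp

lemma set_dist_triangle: "set_dist x S \<le> ereal (norm (x - y)) + set_dist y S"
proof -
  have "set_dist x S - ereal (norm (x - y)) \<le> set_dist y S"
    unfolding set_dist_def[of y]
  proof (rule INF_greatest)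
    fix s assume "s \<in> S"
    have "norm (x - s) \<le> norm (y - s) + norm (x - y)"
      using norm_triangle_ineq[of "x - y" "y - s"] by simp
    then have "set_dist x S \<le> ereal (norm (y - s)) + ereal (norm (x - y))"
      using set_dist_le[OF \<open>s \<in> S\<close>, of x] by (simp add: order_trans)
    then show "set_dist x S - ereal (norm (x - y)) \<le> ereal (norm (y - s))"
      by (simp add: ereal_minus_le)
  qed
  then show ?thesis by (simp add: ereal_minus_le add.commute)
qed

theorem lemma3p3:
  fixes A :: "'a::real_inner \<Rightarrow> 'a set"
    and B :: "'a \<Rightarrow> 'a"
    and \<beta> \<gamma> :: real
    and zstar :: 'a
  assumes finite_dim: "\<exists>S::'a set. finite S \<and> span S = UNIV"
    and A: "maximal_monotone_op A"
    and \<beta>: "\<beta> > 0"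
    and B: "(1 / \<beta>)-lipschitz_on UNIV B"
    and \<gamma>: "\<gamma> > 0"
  shows "metrically_subregular (\<lambda>z. {fb_residual \<gamma> A B z}) zstar 0 \<longleftrightarrow>
         metrically_subregular (\<lambda>z. {a + B z | a. a \<in> A z}) zstar 0"
proof -
  define J where "J = (\<lambda>z. the_elem (resolvent \<gamma> A z))"
  define F where "F = (\<lambda>z. {a + B z | a. a \<in> A z})"
  define R where "R = fb_residual \<gamma> A B"
  have R: "R z = z - J (z - \<gamma> *\<^sub>R B z)" for z
    by (simp add: R_def J_def fb_residual_def)
  have mono: "monotone_op A"
    using A by (simp add: maximal_monotone_op_def)
  have J_eq: "J (x + \<gamma> *\<^sub>R u) = x" if "u \<in> A x" for x u
    unfolding J_def by (rule resolvent_eqI[OF mono \<gamma> that])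
  have J_nonexp: "norm (J z - J z') \<le> norm (z - z')" for z z'
    unfolding J_def by (rule resolvent_nonexpansive[OF finite_dim A \<gamma>])
  have B_lip: "norm (B z - B z') \<le> (1 / \<beta>) * norm (z - z')" for z z'
    using lipschitz_onD[OF B, of z z'] by (simp add: dist_norm)

  have F_le: "norm (R z) \<le> \<gamma> * norm v" if "v \<in> F z" for z v
  proof -
    obtain a where a: "a \<in> A z" "v = a + B z" using \<open>v \<in> F z\<close> by (auto simp: F_def)
    have "R z = J (z + \<gamma> *\<^sub>R a) - J (z - \<gamma> *\<^sub>R B z)"
      using J_eq[OF a(1)] by (simp add: R)
    also have "norm \<dots> \<le> norm (\<gamma> *\<^sub>R v)"
      using J_nonexp[of "z + \<gamma> *\<^sub>R a" "z - \<gamma> *\<^sub>R B z"] by (simp add: a(2) algebra_simps)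
    finally show ?thesis using \<gamma> by simp
  qed
  have R_step: "(1 / \<gamma>) *\<^sub>R R z - B z + B (z - R z) \<in> F (z - R z)" for z
  proof -
    obtain u where u: "u \<in> A (J (z - \<gamma> *\<^sub>R B z))" "z - \<gamma> *\<^sub>R B z = J (z - \<gamma> *\<^sub>R B z) + \<gamma> *\<^sub>R u"
      using resolventE[OF finite_dim A \<gamma>] unfolding J_def by blast
    have "\<gamma> *\<^sub>R u = R z - \<gamma> *\<^sub>R B z" using u(2) by (simp add: R algebra_simps)
    then have "(1 / \<gamma>) *\<^sub>R (\<gamma> *\<^sub>R u) = (1 / \<gamma>) *\<^sub>R (R z - \<gamma> *\<^sub>R B z)" by simp
    then have "u = (1 / \<gamma>) *\<^sub>R R z - B z"
      using \<gamma> by (simp add: scaleR_diff_right)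
    then show ?thesis using u(1) by (auto simp: F_def R)
  qed
  have zero_iff: "R z = 0 \<longleftrightarrow> 0 \<in> F z" for z
    using R_step[of z] F_le[of 0 z] by auto

  \<comment> \<open>The common set of zeros of the two operators\<close>
  define S where "S = {z. 0 \<in> F z}"
  have inv: "inverse_op F 0 = S" "inverse_op (\<lambda>z. {R z}) 0 = S"
    using zero_iff by (auto simp: inverse_op_def S_def)
  have "metrically_subregular (\<lambda>z. {R z}) zstar 0 \<longleftrightarrow> metrically_subregular F zstar 0"
    (is "?lhs \<longleftrightarrow> ?rhs")
  proof
    assume ?lhs
    then obtain \<kappa> U where k: "0 \<in> F zstar" "\<kappa> > 0" "open U" "zstar \<in> U"
      "\<And>x. x \<in> U \<Longrightarrow> set_dist x S \<le> ereal (\<kappa> * norm (R x))"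
      using zero_iff[of zstar] by (auto simp: metrically_subregular_def graph_op_def inv)
    have "set_dist x S \<le> ereal (\<kappa> * \<gamma>) * set_dist 0 (F x)" if "x \<in> U" for x
    proof -
      have "set_dist x S / ereal (\<kappa> * \<gamma>) \<le> set_dist 0 (F x)"
        unfolding set_dist_def[of 0]
      \<comment> \<open>This includes the case \<open>F x = {}\<close>, where the right-hand side is infinite.\<close>
      proof (rule INF_greatest)
        fix v assume "v \<in> F x"
        have "set_dist x S \<le> ereal (\<kappa> * norm (R x))" using k(5) that .
        also have "\<dots> \<le> ereal (\<kappa> * \<gamma>) * ereal (norm (0 - v))"
          using F_le[OF \<open>v \<in> F x\<close>] k(2) by (simp add: mult.assoc)
        finally show "set_dist x S / ereal (\<kappa> * \<gamma>) \<le> ereal (norm (0 - v))"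
          using k(2) \<gamma> by (subst ereal_divide_le_pos) auto
      qed
      then show ?thesis
        using k(2) \<gamma> by (subst (asm) ereal_divide_le_pos) auto
    qed
    then show ?rhs
      unfolding metrically_subregular_def inv
      using k \<gamma> by (intro conjI exI[of _ "\<kappa> * \<gamma>"] exI[of _ U]) (auto simp: graph_op_def)
  next
    assume ?rhs
    then obtain \<kappa> U where k: "0 \<in> F zstar" "\<kappa> > 0" "open U" "zstar \<in> U"
      "\<And>x. x \<in> U \<Longrightarrow> set_dist x S \<le> ereal \<kappa> * set_dist 0 (F x)"
      by (auto simp: metrically_subregular_def graph_op_def inv)
    obtain e where e: "e > 0" "ball zstar e \<subseteq> U"
      using k(3,4) open_contains_ball by blast
    define L where "L = 1 + \<gamma> / \<beta>"
    define M where "M = 1 + \<kappa> * (1 / \<gamma> + 1 / \<beta>)"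
    have "L > 0" "M > 0" using \<beta> \<gamma> k(2) by (auto simp: L_def M_def add_pos_pos)
    have "set_dist z S \<le> ereal M * ereal (norm (R z))" if z: "z \<in> ball zstar (e / L)" for z
    proof -
      define p where "p = z - R z"
      \<comment> \<open>The forward-backward map fixes \<open>zstar\<close> and is Lipschitz with constant \<open>L\<close>.\<close>
      have "p - zstar = J (z - \<gamma> *\<^sub>R B z) - J (zstar - \<gamma> *\<^sub>R B zstar)"
        using R[of z] R[of zstar] zero_iff[of zstar] k(1) by (simp add: p_def)
      also have "norm \<dots> \<le> norm ((z - zstar) - \<gamma> *\<^sub>R (B z - B zstar))"
        using J_nonexp[of "z - \<gamma> *\<^sub>R B z" "zstar - \<gamma> *\<^sub>R B zstar"] by (simp add: algebra_simps)
      also have "\<dots> \<le> norm (z - zstar) + \<gamma> * norm (B z - B zstar)"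
        using norm_triangle_ineq4[of "z - zstar" "\<gamma> *\<^sub>R (B z - B zstar)"] \<gamma> by simp
      also have "\<dots> \<le> norm (z - zstar) + \<gamma> * ((1 / \<beta>) * norm (z - zstar))"
        using B_lip \<gamma> by (intro add_left_mono mult_left_mono) auto
      also have "\<dots> = L * norm (z - zstar)" by (simp add: L_def algebra_simps)
      also have "\<dots> < e"
        using z \<open>L > 0\<close> by (simp add: dist_norm norm_minus_commute field_simps)
      finally have "p \<in> U" using e(2) by (auto simp: dist_norm norm_minus_commute)
      let ?v = "(1 / \<gamma>) *\<^sub>R R z - B z + B p"
      have "norm ?v \<le> norm ((1 / \<gamma>) *\<^sub>R R z) + norm (B p - B z)"
        using norm_triangle_ineq[of "(1 / \<gamma>) *\<^sub>R R z" "B p - B z"] by (simp add: algebra_simps)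
      also have "\<dots> \<le> (1 / \<gamma> + 1 / \<beta>) * norm (R z)"
        using B_lip[of p z] \<gamma> by (simp add: p_def algebra_simps)
      finally have v: "norm ?v \<le> (1 / \<gamma> + 1 / \<beta>) * norm (R z)" .
      have "set_dist 0 (F p) \<le> ereal (norm ?v)"
        using set_dist_le[OF R_step, of 0 z] by (simp only: p_def norm_minus_cancel diff_0)
      also have "\<dots> \<le> ereal ((1 / \<gamma> + 1 / \<beta>) * norm (R z))" using v by simp
      finally have "ereal \<kappa> * set_dist 0 (F p) \<le> ereal \<kappa> * ereal ((1 / \<gamma> + 1 / \<beta>) * norm (R z))"
        using k(2) by (intro ereal_mult_left_mono) auto
      then have "set_dist p S \<le> ereal (\<kappa> * ((1 / \<gamma> + 1 / \<beta>) * norm (R z)))"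
        using k(5)[OF \<open>p \<in> U\<close>] by (simp add: order_trans)
      then have "ereal (norm (z - p)) + set_dist p S
          \<le> ereal (norm (R z)) + ereal (\<kappa> * ((1 / \<gamma> + 1 / \<beta>) * norm (R z)))"
        by (intro add_mono) (auto simp: p_def)
      also have "\<dots> = ereal M * ereal (norm (R z))"
        by (simp add: M_def algebra_simps)
      finally show ?thesis
        using set_dist_triangle[of z S p] by (rule order_trans[rotated])
    qed
    then show ?lhs
      unfolding metrically_subregular_def inv
      using k(1) zero_iff[of zstar] e(1) \<open>L > 0\<close> \<open>M > 0\<close>
      by (intro conjI exI[of _ M] exI[of _ "ball zstar (e / L)"]) (auto simp: graph_op_def)
  qed
  then show ?thesis by (simp add: R_def F_def)
qed

end
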